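(* Let $q$ be an odd prime power, let $\ell$ be an odd integer and $d$ an even integer with $0<d<2\ell$ and $\gcd(\ell,d)=1$. Let $\omega\in\mathbb{F}_{q^2}\setminus\mathbb{F}_q$ with $\omega^2=\sigma\in\mathbb{F}_q^*$, and let $\beta$ be a nonsquare in $\mathbb{F}_{q^{2\ell}}$. Let $(\mathbb{F}_{q^{2\ell}},+,\star')$ be the presemifield with multiplication $$x\star' y=2Ax^{q^\ell}+2\sigma^{q^{2\ell-d}}\beta^{q^{2\ell-d}}B^{q^{2\ell-d}}x^{q^{2\ell-d}}+2\sigma\beta Bx^{q^d},\qquad y=A+B\omega,\ A,B\in\mathbb{F}_{q^\ell}.$$ Then there exists $\xi\in\mathbb{F}_{q^{2\ell}}$ with $\xi^{q^{\ell+d}-1}=\beta^{1-q^\ell}$ and $\xi^{q^\ell+1}=\sigma$ such that $(\mathbb{F}_{q^{2\ell}},+,\star')$ is isotopic to the presemifield $(\mathbb{F}_{q^{2\ell}},+,\star'')$ with multiplication $$x\star'' y=2\Big(Ax+\sigma B\omega\frac{\beta}{\xi^{q^\ell}}x^{q^d}+\sigma B^{q^{2\ell-d}}\omega\frac{\beta^{q^{2\ell-d}}}{\xi^{q^\ell}}x^{q^{2\ell-d}}\Big),\qquad y=A+B\omega,\ A,B\in\mathbb{F}_{q^\ell}.$$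
   Context: Every $y\in\mathbb{F}_{q^{2\ell}}$ is uniquely $y=A+B\omega$ with $A,B\in\mathbb{F}_{q^\ell}$. The presemifield $(\mathbb{F}_{q^{2\ell}},+,\star')$ is the dual of the transpose of the commutative presemifield $\overline{B}(q,\ell,d,\beta)=(\mathbb{F}_{q^{2\ell}},+,\star)$ with $x\star y=xy^{q^\ell}+x^{q^\ell}y+[\beta(xy^{q^d}+x^{q^d}y)+\beta^{q^\ell}(xy^{q^d}+x^{q^d}y)^{q^\ell}]\omega$. A presemifield is the additive group of the field with a multiplication satisfying both distributive laws and no zero divisors. Presemifields $(\mathbb{F}_{q^{2\ell}},+,\bullet)$, $(\mathbb{F}_{q^{2\ell}},+,\star)$ are isotopic if there are additive (i.e. $\mathbb{F}_p$-linear, $p$ the characteristic) permutations $M,N,L$ with $M(x)\star N(y)=L(x\bullet y)$ for all $x,y$. *)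

theory Defs
  imports
    "HOL-Number_Theory.Number_Theory"
    "HOL-Computational_Algebra.Computational_Algebra"
    "HOL-Library.Cardinality"
begin

text \<open>
  The field with \<open>q ^ (2 * l)\<close> elements is modelled by a type \<open>'a :: finite_field\<close> with
  \<open>CARD('a) = q ^ (2 * l)\<close>. Its subfield with \<open>q ^ k\<close> elements (\<open>k\<close> dividing \<open>2 * l\<close>) is the set
  of fixed points of \<open>x \<mapsto> x ^ (q ^ k)\<close>; the lemmas \<open>subfield_Fq_closed\<close> and \<open>card_subfield_Fq\<close>
  justify this.
\<close>

definition subfield_Fq :: "nat \<Rightarrow> nat \<Rightarrow> 'a :: finite_field set" where
  "subfield_Fq q k = {x. x ^ (q ^ k) = x}"

lemma finite_field_CHAR_power:
  assumes "primepow q" "CARD('a :: finite_field) = q ^ n"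
  obtains m where "m > 0" "q = CHAR('a) ^ m"
proof -
  obtain p m where pm: "prime p" "m > 0" "q = p ^ m"
    using assms(1) by (auto simp: primepow_def)
  have c: "prime CHAR('a)"
    by (rule prime_CHAR_semidom) (simp add: finite_imp_CHAR_pos)
  have "CHAR('a) dvd p ^ (m * n)"
    using CHAR_dvd_CARD[where 'a = 'a] assms(2) pm(3) by (simp add: power_mult)
  hence "CHAR('a) dvd p"
    using c prime_dvd_power by blast
  hence "CHAR('a) = p"
    using c pm(1) primes_dvd_imp_eq by blast
  thus ?thesis using that pm by blast
qed

lemma subfield_Fq_closed:
  fixes x y :: "'a :: finite_field"
  assumes "primepow q" "CARD('a) = q ^ n"
  shows "(0 :: 'a) \<in> subfield_Fq q k" "(1 :: 'a) \<in> subfield_Fq q k"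
    and "x \<in> subfield_Fq q k \<Longrightarrow> y \<in> subfield_Fq q k \<Longrightarrow> x + y \<in> subfield_Fq q k"
    and "x \<in> subfield_Fq q k \<Longrightarrow> y \<in> subfield_Fq q k \<Longrightarrow> x - y \<in> subfield_Fq q k"
    and "x \<in> subfield_Fq q k \<Longrightarrow> y \<in> subfield_Fq q k \<Longrightarrow> x * y \<in> subfield_Fq q k"
    and "x \<in> subfield_Fq q k \<Longrightarrow> y \<in> subfield_Fq q k \<Longrightarrow> x / y \<in> subfield_Fq q k"
proof -
  obtain m where m: "m > 0" "q = CHAR('a) ^ m"
    using finite_field_CHAR_power[OF assms] .
  have c: "prime CHAR('a)"
    by (rule prime_CHAR_semidom) (simp add: finite_imp_CHAR_pos)
  have add: "(u + v) ^ (q ^ k) = u ^ (q ^ k) + v ^ (q ^ k)" for u v :: 'a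
    by (rule freshmans_dream'[OF c, of _ "m * k"]) (simp add: m power_mult)
  have diff: "(u - v) ^ (q ^ k) = u ^ (q ^ k) - v ^ (q ^ k)" for u v :: 'a
    using add[of "u - v" v] by (simp add: algebra_simps)
  have q: "q > 0" using m(2) c prime_gt_0_nat by simp
  show "(0 :: 'a) \<in> subfield_Fq q k" "(1 :: 'a) \<in> subfield_Fq q k"
    using q by (auto simp: subfield_Fq_def)
  assume "x \<in> subfield_Fq q k" "y \<in> subfield_Fq q k"
  thus "x + y \<in> subfield_Fq q k" "x - y \<in> subfield_Fq q k"
       "x * y \<in> subfield_Fq q k" "x / y \<in> subfield_Fq q k"
    by (simp_all add: subfield_Fq_def add diff power_mult_distrib power_divide)
qed

lemma card_subfield_Fq:
  assumes "primepow q" "CARD('a :: finite_field) = q ^ n" "k dvd n" "k > 0" "n > 0"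
  shows "card (subfield_Fq q k :: 'a set) = q ^ k"
proof -
  define Q where "Q = q ^ k"
  define X where "X = (\<lambda>m. monom 1 m - 1 :: 'a poly)"
  have q: "q > 1" using primepow_gt_Suc_0[OF assms(1)] by simp
  have Q: "Q > 1" unfolding Q_def by (rule one_less_power[OF q assms(4)])
  obtain r where r: "n = k * r" using assms(3) by blast
  have N: "q ^ n = Q ^ r" by (simp add: r Q_def power_mult)
  have rpos: "r > 0" using r assms(5) by auto
  have "Q - 1 dvd Q ^ r - 1"
  proof -
    have "[Q = 1] (mod (Q - 1))" using Q by (simp add: cong_def mod_if le_mod_geq)
    hence "[Q ^ r = 1 ^ r] (mod (Q - 1))" by (rule cong_pow)
    hence "[Q ^ r = 1] (mod (Q - 1))" by simp
    thus ?thesis by (rule cong_to_1_nat)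
  qed
  then obtain s where s: "Q ^ r - 1 = (Q - 1) * s" by blast
  have Nr: "Q ^ r > 1" by (rule one_less_power[OF Q rpos])
  have spos: "s > 0" using s Nr by (cases s) auto
  define S where "S = (\<Sum>i<s. monom 1 ((Q - 1) * i) :: 'a poly)"
  have fac: "X (Q ^ r - 1) = X (Q - 1) * S"
  proof -
    have "X (Q ^ r - 1) = (monom 1 (Q - 1)) ^ s - 1"
      unfolding X_def s by (simp add: monom_power)
    also have "\<dots> = (monom 1 (Q - 1) - 1) * (\<Sum>i<s. (monom 1 (Q - 1)) ^ i)"
      by (rule power_diff_1_eq)
    finally show ?thesis by (simp add: X_def S_def monom_power)
  qed
  have X0: "X m \<noteq> 0" and dX: "degree (X m) = m" if "m > 0" for m
  proof -
    have "degree (- 1 :: 'a poly) < degree (monom (1 :: 'a) m)"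
      using that by (simp add: degree_monom_eq)
    from degree_add_eq_left[OF this] show d: "degree (X m) = m"
      by (simp add: X_def degree_monom_eq)
    show "X m \<noteq> 0" using d that by auto
  qed
  have fin: "finite A" for A :: "'a set" by simp
  have S0: "S \<noteq> 0" using fac X0[of "Q ^ r - 1"] Nr by auto
  have dS: "degree S = (Q ^ r - 1) - (Q - 1)"
    using arg_cong[OF fac, of degree] dX[of "Q ^ r - 1"] dX[of "Q - 1"] X0[of "Q - 1"] S0 Nr Q
    by (simp add: degree_mult_eq)
  have pX: "poly (X m) x = x ^ m - 1" for m x by (simp add: X_def poly_monom)
  have root: "x ^ m = x \<longleftrightarrow> x = 0 \<or> poly (X (m - 1)) x = 0" if "m > 0" for m and x :: 'a
    using that by (cases m) (auto simp: pX)
  have sub: "UNIV - {0} \<subseteq> {x. poly (X (Q - 1)) x = 0} \<union> {x. poly S x = 0}"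
  proof
    fix x :: 'a assume "x \<in> UNIV - {0}"
    hence "poly (X (Q ^ r - 1)) x = 0"
      using finite_field_power_card_eq_same[of x] root[of "Q ^ r" x] Nr assms(2) N
      by (metis DiffD2 insertCI less_trans zero_less_one)
    hence "poly (X (Q - 1) * S) x = 0" by (simp only: fac)
    thus "x \<in> {x. poly (X (Q - 1)) x = 0} \<union> {x. poly S x = 0}" by simp
  qed
  have "Q ^ r - 1 = card (UNIV - {0 :: 'a})"
    using assms(2) N by (simp add: card_Diff_subset)
  also have "\<dots> \<le> card ({x. poly (X (Q - 1)) x = 0} \<union> {x. poly S x = 0})"
    by (intro card_mono sub fin)
  also have "\<dots> \<le> card {x. poly (X (Q - 1)) x = 0} + card {x. poly S x = 0}"
    by (rule card_Un_le)
  also have "card {x. poly S x = 0} \<le> (Q ^ r - 1) - (Q - 1)"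
    using card_poly_roots_bound[OF S0] dS by simp
  finally have ge: "Q - 1 \<le> card {x. poly (X (Q - 1)) x = 0}"
    using Q rpos self_le_power[of Q r] by linarith
  have le: "card {x. poly (X (Q - 1)) x = 0} \<le> Q - 1"
    using card_poly_roots_bound[OF X0[of "Q - 1"]] dX[of "Q - 1"] Q by simp
  have "(subfield_Fq q k :: 'a set) = insert 0 {x. poly (X (Q - 1)) x = 0}"
    using root[OF order.strict_trans[OF zero_less_one Q]]
    unfolding subfield_Fq_def Q_def [symmetric] by blast
  moreover have "0 \<notin> {x. poly (X (Q - 1)) x = 0}" using Q by (simp add: pX zero_power)
  ultimately have "card (subfield_Fq q k :: 'a set) = Suc (card {x. poly (X (Q - 1)) x = 0})"
    using fin by simp
  thus ?thesis using ge le Q Q_def by simp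
qed

text \<open>
  The pair \<open>(A, B)\<close> of elements of the subfield with \<open>q ^ l\<close> elements such that
  \<open>y = A + B * \<omega>\<close>; see \<open>omega_coords_unique\<close>.
\<close>

definition omega_coords :: "nat \<Rightarrow> nat \<Rightarrow> 'a :: finite_field \<Rightarrow> 'a \<Rightarrow> 'a \<times> 'a" where
  "omega_coords q l \<omega> y =
     (THE AB. fst AB \<in> subfield_Fq q l \<and> snd AB \<in> subfield_Fq q l \<and> y = fst AB + snd AB * \<omega>)"

lemma omega_coords_unique:
  fixes \<omega> y :: "'a :: finite_field"
  assumes "primepow q" "odd l" "CARD('a) = q ^ (2 * l)"
    and "\<omega> \<in> subfield_Fq q 2" "\<omega> \<notin> subfield_Fq q 1"
  shows "\<exists>!AB. fst AB \<in> subfield_Fq q l \<and> snd AB \<in> subfield_Fq q l \<and> y = fst AB + snd AB * \<omega>"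
proof -
  let ?K = "subfield_Fq q l :: 'a set"
  have lpos: "l > 0" using assms(2) by (cases l) auto
  note cl = subfield_Fq_closed[OF assms(1,3)]
  have cardK: "card ?K = q ^ l"
    using lpos by (intro card_subfield_Fq[OF assms(1,3)]) auto
  obtain j where j: "l = 2 * j + 1" using assms(2) by (elim oddE)
  have it: "\<omega> ^ (q ^ (2 * i)) = \<omega>" for i
  proof (induction i)
    case (Suc i)
    have "\<omega> ^ (q ^ (2 * Suc i)) = (\<omega> ^ (q ^ (2 * i))) ^ (q ^ 2)"
      by (simp flip: power_mult power_add add: add.commute)
    thus ?case using Suc assms(4) by (simp add: subfield_Fq_def)
  qed auto
  have "\<omega> ^ (q ^ l) = (\<omega> ^ (q ^ (2 * j))) ^ q"
    by (simp add: j mult.commute flip: power_mult)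
  hence \<omega>K: "\<omega> \<notin> ?K" using it[of j] assms(5) by (simp add: subfield_Fq_def)
  define f where "f = (\<lambda>AB :: 'a \<times> 'a. fst AB + snd AB * \<omega>)"
  have inj: "inj_on f (?K \<times> ?K)"
  proof (rule inj_onI; clarify)
    fix A B C D assume K: "A \<in> ?K" "B \<in> ?K" "C \<in> ?K" "D \<in> ?K" and "f (A, B) = f (C, D)"
    hence e: "A - C = (D - B) * \<omega>" by (simp add: f_def algebra_simps)
    have "D = B"
    proof (rule ccontr)
      assume "D \<noteq> B"
      hence "\<omega> = (A - C) / (D - B)" using e by (simp add: field_simps)
      thus False using \<omega>K cl(4,6) K by metis
    qed
    thus "A = C \<and> B = D" using e by simp
  qed
  have "card (f ` (?K \<times> ?K)) = CARD('a)"
    using card_image[OF inj] cardK assms(3) by (simp add: card_cartesian_product mult_2 power_add)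
  hence "f ` (?K \<times> ?K) = UNIV"
    by (intro card_subset_eq) auto
  then obtain P where P: "P \<in> ?K \<times> ?K" "y = f P" by blast
  show ?thesis
  proof (rule ex1I[of _ P])
    show "fst P \<in> ?K \<and> snd P \<in> ?K \<and> y = fst P + snd P * \<omega>" using P by (auto simp: f_def)
    fix P' assume "fst P' \<in> ?K \<and> snd P' \<in> ?K \<and> y = fst P' + snd P' * \<omega>"
    thus "P' = P" using P inj_onD[OF inj, of P' P] by (auto simp: f_def mem_Times_iff)
  qed
qed

definition presemifield :: "('a :: ab_group_add \<Rightarrow> 'a \<Rightarrow> 'a) \<Rightarrow> bool" where
  "presemifield m \<longleftrightarrow>
     (\<forall>x y z. m x (y + z) = m x y + m x z) \<and>
     (\<forall>x y z. m (x + y) z = m x z + m y z) \<and>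
     (\<forall>x y. m x y = 0 \<longrightarrow> x = 0 \<or> y = 0)"

definition isotopic ::
  "('a :: ab_group_add \<Rightarrow> 'a \<Rightarrow> 'a) \<Rightarrow> ('a \<Rightarrow> 'a \<Rightarrow> 'a) \<Rightarrow> bool" where
  "isotopic m1 m2 \<longleftrightarrow>
     (\<exists>M N L. additive M \<and> bij M \<and> additive N \<and> bij N \<and> additive L \<and> bij L \<and>
        (\<forall>x y. m2 (M x) (N y) = L (m1 x y)))"

definition star_prime ::
  "nat \<Rightarrow> nat \<Rightarrow> nat \<Rightarrow> 'a :: finite_field \<Rightarrow> 'a \<Rightarrow> 'a \<Rightarrow> 'a \<Rightarrow> 'a \<Rightarrow> 'a" where
  "star_prime q l d \<omega> \<sigma> \<beta> x y =
     (let (A, B) = omega_coords q l \<omega> y in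
        2 * A * x ^ (q ^ l)
      + 2 * \<sigma> ^ (q ^ (2 * l - d)) * \<beta> ^ (q ^ (2 * l - d)) * B ^ (q ^ (2 * l - d))
          * x ^ (q ^ (2 * l - d))
      + 2 * \<sigma> * \<beta> * B * x ^ (q ^ d))"

definition star_dprime ::
  "nat \<Rightarrow> nat \<Rightarrow> nat \<Rightarrow> 'a :: finite_field \<Rightarrow> 'a \<Rightarrow> 'a \<Rightarrow> 'a \<Rightarrow> 'a \<Rightarrow> 'a \<Rightarrow> 'a" where
  "star_dprime q l d \<omega> \<sigma> \<beta> \<xi> x y =
     (let (A, B) = omega_coords q l \<omega> y in
        2 * (A * x
           + \<sigma> * B * \<omega> * (\<beta> / \<xi> ^ (q ^ l)) * x ^ (q ^ d)
           + \<sigma> * B ^ (q ^ (2 * l - d)) * \<omega> * (\<beta> ^ (q ^ (2 * l - d)) / \<xi> ^ (q ^ l))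
               * x ^ (q ^ (2 * l - d))))"

end

theory Submission
  imports Defs
begin

text \<open>
  Write \<open>s\<close> for the \<open>q ^ d\<close>-power map, conjugation for the \<open>q ^ l\<close>-power map, \<open>F\<close> for the big field and
  \<open>K\<close> for its subfield with \<open>q ^ l\<close> elements. Every element of \<open>K\<close> is a square in \<open>F\<close>.

  If \<open>x \<star>' y = 0\<close> with \<open>x \<noteq> 0\<close>, then \<open>e = \<sigma> \<beta> B x s(x)\<close> has \<open>e + s\<^sup>-\<^sup>1(e) \<in> K\<close>. Hence \<open>s\<close> negates
  \<open>e\<close> minus its conjugate, which forces \<open>e \<in> K\<close>; since \<open>\<sigma> B x s(x)\<close> is a square and \<open>\<beta>\<close> is
  not, \<open>B = 0\<close> and then \<open>A = 0\<close>.

  The condition \<open>\<xi> ^ (q ^ (l + d) - 1) = \<beta> ^ (1 - q ^ l)\<close> determines \<open>\<xi>\<close> up to a factor in the field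
  with \<open>q\<close> elements, and the norm \<open>n\<close> of \<open>\<xi>\<close> to \<open>K\<close> lies in that field. If \<open>n\<close> were a square there,
  Hilbert 90 would make \<open>\<beta>\<close> a square; so \<open>n\<close> and \<open>\<sigma>\<close> are both nonsquares and rescaling \<open>\<xi>\<close>
  yields \<open>n = \<sigma>\<close>.

  With \<open>a\<close> the quotient of \<open>\<omega>\<close> by the conjugate of \<open>\<xi>\<close>, which has norm \<open>-1\<close>, the isotopism consists
  of \<open>M(x)\<close> = \<open>x\<close> plus \<open>a\<close> times the conjugate of \<open>x\<close>, of \<open>L(z)\<close> = \<open>a z\<close> plus the conjugate of \<open>z\<close>,
  and of the identity.
\<close>

section \<open>Roots in finite fields and transfer along isotopisms\<close>

text \<open>Counting takes the place of cyclicity of the multiplicative group. Each nonempty fibre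
  of \<open>x ^ n\<close> on nonzero elements has at most \<open>k\<close> points, so at least
  \<open>m\<close> values occur. All of them are roots of \<open>X ^ m - 1\<close>, which has at
  most \<open>m\<close> roots, so every root is a value.\<close>

lemma finite_field_nth_root:
  fixes z :: "'a :: finite_field"
  assumes ker: "card {x :: 'a. x ^ n = 1} \<le> k" and km: "k * m = CARD('a) - 1"
    and nm: "CARD('a) - 1 dvd n * m" and z: "z ^ m = 1"
  shows "\<exists>x. x \<noteq> 0 \<and> x ^ n = z"
proof -
  let ?U = "UNIV - {0 :: 'a}"
  let ?I = "(\<lambda>x. x ^ n) ` ?U"
  have cardU: "card ?U = k * m"
    by (simp add: km card_Diff_subset)
  have "card {0, 1 :: 'a} \<le> CARD('a)"
    by (intro card_mono) auto
  hence pos: "k > 0" "m > 0"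
    using km by (cases k; cases m; simp)+
  have fibre: "card {x \<in> ?U. x ^ n = v} \<le> k" if "v \<in> ?I" for v
  proof -
    obtain u where u: "u \<noteq> 0" "v = u ^ n" using \<open>v \<in> ?I\<close> by auto
    have "card {x \<in> ?U. x ^ n = v} \<le> card {x :: 'a. x ^ n = 1}"
      by (rule card_inj_on_le[where f = "\<lambda>x. x / u"])
         (use u in \<open>auto simp: inj_on_def power_divide\<close>)
    thus ?thesis using ker by simp
  qed
  have "k * m = card (\<Union>v\<in>?I. {x \<in> ?U. x ^ n = v})"
    unfolding cardU[symmetric] by (rule arg_cong[where f = card]) auto
  also have "\<dots> \<le> (\<Sum>v\<in>?I. card {x \<in> ?U. x ^ n = v})"
    by (rule card_UN_le) simp
  also have "\<dots> \<le> card ?I * k"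
    using sum_bounded_above[of ?I "\<lambda>v. card {x \<in> ?U. x ^ n = v}" k] fibre by simp
  finally have m_le: "m \<le> card ?I" using pos by (simp add: mult.commute)
  define P where "P = monom 1 m - (1 :: 'a poly)"
  have poly_P: "poly P x = x ^ m - 1" for x by (simp add: P_def poly_monom)
  have P0: "P \<noteq> 0" using poly_P[of 0] pos by (auto simp: power_0_left)
  have "degree P \<le> m"
    unfolding P_def by (intro degree_diff_le) (auto simp: degree_monom_le)
  hence roots: "card {x. poly P x = 0} \<le> m"
    using card_poly_roots_bound[OF P0] by simp
  have "?I \<subseteq> {x. poly P x = 0}"
  proof
    fix v assume "v \<in> ?I"
    then obtain u where u: "u \<noteq> 0" "v = u ^ n" by auto
    obtain t where t: "n * m = (CARD('a) - 1) * t" using nm by blast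
    have "u * u ^ (CARD('a) - 1) = u"
      using finite_field_power_card_eq_same[of u] pos km
      by (metis One_nat_def Suc_pred finite_UNIV_card_ge_0 finite power_Suc)
    hence "u ^ (CARD('a) - 1) = 1" using u(1) by simp
    hence "v ^ m = 1" by (simp add: u(2) t power_mult flip: power_mult[of u n m])
    thus "v \<in> {x. poly P x = 0}" by (simp add: poly_P)
  qed
  with m_le roots have "?I = {x. poly P x = 0}"
    by (intro card_subset_eq) (auto intro: card_mono le_antisym dest: card_mono[rotated])
  moreover have "z \<in> {x. poly P x = 0}" using z by (simp add: poly_P)
  ultimately have "z \<in> ?I" by simp
  thus ?thesis by auto
qed

text \<open>Spares \<open>star_dprime\<close> a zero-divisor argument of its own.\<close>

lemma isotopic_presemifield:
  assumes iso: "isotopic m1 m2" and pre: "presemifield m1"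
  shows "presemifield m2"
proof -
  obtain M N L where add: "additive M" "additive N" "additive L"
    and bij: "bij M" "bij N" "bij L" and eq: "\<And>x y. m2 (M x) (N y) = L (m1 x y)"
    using iso unfolding isotopic_def by blast
  have dist: "m1 x (y + z) = m1 x y + m1 x z" "m1 (x + y) z = m1 x z + m1 y z"
    and zero: "m1 x y = 0 \<Longrightarrow> x = 0 \<or> y = 0" for x y z
    using pre unfolding presemifield_def by blast+
  have surj: "\<exists>u. x = M u" "\<exists>u. x = N u" for x
    using bij by (metis bij_pointE)+
  have 1: "m2 x (y + z) = m2 x y + m2 x z" for x y z
    using surj[of x] surj[of y] surj[of z] additive.add[OF add(2)] additive.add[OF add(3)] eq dist
    by metis
  have 2: "m2 (x + y) z = m2 x z + m2 y z" for x y z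
    using surj[of x] surj[of y] surj[of z] additive.add[OF add(1)] additive.add[OF add(3)] eq dist
    by metis
  have 3: "x = 0 \<or> y = 0" if "m2 x y = 0" for x y
  proof -
    obtain u v where uv: "x = M u" "y = N v" using surj by metis
    have "L (m1 u v) = L 0" using that uv eq additive.zero[OF add(3)] by simp
    hence "u = 0 \<or> v = 0" using bij(3) zero by (metis bij_def injD)
    thus ?thesis using uv additive.zero[OF add(1)] additive.zero[OF add(2)] by auto
  qed
  show ?thesis unfolding presemifield_def using 1 2 3 by blast
qed

section \<open>Powers of the Frobenius map and their fixed fields\<close>

locale quadratic_setting =
  fixes q l d :: nat and \<omega> \<sigma> \<beta> :: "'a :: finite_field"
  assumes q_pp: "primepow q" and q_odd: "odd q"
    and l_odd: "odd l" and d_even: "even d" and d_pos: "0 < d" and d_less: "d < 2 * l"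
    and gcd_ld: "gcd l d = 1"
    and card_F: "CARD('a) = q ^ (2 * l)"
    and \<omega>2: "\<omega> \<in> subfield_Fq q 2" and \<omega>1: "\<omega> \<notin> subfield_Fq q 1"
    and \<sigma>1: "\<sigma> \<in> subfield_Fq q 1" and \<sigma>0: "\<sigma> \<noteq> 0" and \<omega>\<sigma>: "\<omega> ^ 2 = \<sigma>"
    and \<beta>_nonsquare: "\<not> is_square \<beta>"
begin

text \<open>In the notation above, \<open>fr l\<close> is conjugation, \<open>fr d\<close> is
  \<open>s\<close> and \<open>fr (2 * l - d)\<close> is its inverse.\<close>

definition fr :: "nat \<Rightarrow> 'a \<Rightarrow> 'a" where
  "fr k x = x ^ (q ^ k)"

lemma q_gt_1: "q > 1"
  using primepow_gt_Suc_0[OF q_pp] by simp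

lemma l_pos: "l > 0"
  using l_odd by (cases l) auto

lemma fr_add: "fr k (x + y) = fr k x + fr k y"
proof -
  obtain m where m: "m > 0" "q = CHAR('a) ^ m"
    using finite_field_CHAR_power[OF q_pp card_F] .
  have "prime CHAR('a)"
    by (rule prime_CHAR_semidom) (simp add: finite_imp_CHAR_pos)
  thus ?thesis
    unfolding fr_def by (rule freshmans_dream'[of _ "m * k"]) (simp add: m power_mult)
qed

lemma fr_0 [simp]: "fr k 0 = 0" and fr_1 [simp]: "fr k 1 = 1"
  using q_gt_1 by (auto simp: fr_def)

lemma fr_minus: "fr k (- x) = - fr k x"
  using fr_add[of k x "- x"] by (simp add: eq_neg_iff_add_eq_0 add.commute)

lemma fr_diff: "fr k (x - y) = fr k x - fr k y"
  using fr_add[of k x "- y"] by (simp add: fr_minus)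

lemma fr_mult: "fr k (x * y) = fr k x * fr k y"
  by (simp add: fr_def power_mult_distrib)

lemma fr_divide: "fr k (x / y) = fr k x / fr k y"
  by (simp add: fr_def power_divide)

lemma fr_power: "fr k (x ^ n) = fr k x ^ n"
  by (simp add: fr_def mult.commute flip: power_mult)

lemma fr_eq_0_iff [simp]: "fr k x = 0 \<longleftrightarrow> x = 0"
  using q_gt_1 by (auto simp: fr_def)

lemma fr_fr: "fr i (fr j x) = fr (i + j) x"
  by (simp add: fr_def power_add mult.commute flip: power_mult)

lemma fr_period [simp]: "fr (2 * l) x = x"
  using finite_field_power_card_eq_same[of x] by (simp add: fr_def card_F)

lemma fr_bar_bar [simp]: "fr l (fr l x) = x"
  using fr_period[of x] by (simp add: fr_fr mult_2)

lemma fr_d_inverse [simp]: "fr d (fr (2 * l - d) x) = x" "fr (2 * l - d) (fr d x) = x"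
  using d_less by (simp_all add: fr_fr)

lemma fr_commute: "fr i (fr j x) = fr j (fr i x)"
  by (simp add: fr_fr add.commute)

lemma mem_subfield_iff: "x \<in> subfield_Fq q k \<longleftrightarrow> fr k x = x"
  by (simp add: subfield_Fq_def fr_def)

lemma fr_fixed_mult: "fr k x = x \<Longrightarrow> fr (k * i) x = x"
proof (induction i)
  case (Suc i)
  have "fr (k * Suc i) x = fr k (fr (k * i) x)" by (simp add: fr_fr)
  thus ?case using Suc by simp
qed (simp add: fr_def)

text \<open>Bezout in the form \<open>i * u = j * v + gcd i j\<close> avoids negative
  exponents.\<close>

lemma fr_fixed_gcd:
  assumes "fr i x = x" "fr j x = x" "i > 0"
  shows "fr (gcd i j) x = x"
proof -
  obtain u v where uv: "i * u = j * v + gcd i j"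
    using bezout_nat[of i j] assms(3) by auto
  have "x = fr (gcd i j) (fr (j * v) x)"
    using fr_fixed_mult[OF assms(1), of u] by (simp add: fr_fr uv add.commute)
  thus ?thesis using fr_fixed_mult[OF assms(2), of v] by simp
qed

lemma two_nonzero: "(2 :: 'a) \<noteq> 0"
proof
  assume "(2 :: 'a) = 0"
  hence dvd: "CHAR('a) dvd 2" by (metis of_nat_numeral of_nat_eq_0_iff_char_dvd)
  obtain m where m: "m > 0" "q = CHAR('a) ^ m"
    using finite_field_CHAR_power[OF q_pp card_F] .
  have "prime CHAR('a)"
    by (rule prime_CHAR_semidom) (simp add: finite_imp_CHAR_pos)
  hence "CHAR('a) = 2" using dvd primes_dvd_imp_eq two_is_prime_nat by blast
  thus False using m q_odd by simp
qed

lemma eq_neg_imp_0: "x = - x \<Longrightarrow> x = (0 :: 'a)"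
  using two_nonzero by (metis add_eq_0_iff2 mult_2 mult_eq_0_iff)

lemma \<omega>_nonzero: "\<omega> \<noteq> 0"
  using \<omega>\<sigma> \<sigma>0 by auto

lemma fr_\<sigma>: "fr k \<sigma> = \<sigma>"
  using fr_fixed_mult[of 1 \<sigma> k] \<sigma>1 by (simp add: mem_subfield_iff)

lemma fr_even_\<omega>: "even k \<Longrightarrow> fr k \<omega> = \<omega>"
  using fr_fixed_mult[of 2 \<omega>] \<omega>2 by (auto simp: mem_subfield_iff elim!: evenE)

lemma fr_1_\<omega>: "fr 1 \<omega> = - \<omega>"
proof -
  have "(fr 1 \<omega>)\<^sup>2 = \<omega>\<^sup>2" using fr_\<sigma>[of 1] fr_power[of 1 \<omega> 2] \<omega>\<sigma> by simp
  thus ?thesis using \<omega>1 by (simp add: mem_subfield_iff power2_eq_iff)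
qed

lemma fr_bar_\<omega>: "fr l \<omega> = - \<omega>"
proof -
  obtain j where j: "l = 2 * j + 1" using l_odd by (elim oddE)
  have "fr l \<omega> = fr 1 (fr (2 * j) \<omega>)" by (simp add: fr_fr j)
  thus ?thesis by (simp only: fr_even_\<omega>[of "2 * j", simplified] fr_1_\<omega>)
qed

text \<open>Both \<open>fr (2 * d)\<close> and \<open>fr (2 * l)\<close> fix \<open>f\<close>, hence
  so does \<open>fr 2\<close>. As \<open>d\<close> is even, \<open>fr d f = f\<close>, so
  \<open>f = - f\<close>, which forces 0 in odd characteristic.\<close>

lemma fr_d_neg_imp_0:
  assumes "fr d f = - f"
  shows "f = 0"
proof -
  have "fr (2 * d) f = f"
    using assms fr_fr[of d d f] by (simp add: fr_minus mult_2)
  hence "fr (gcd (2 * d) (2 * l)) f = f"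
    using fr_fixed_gcd fr_period d_pos by simp
  moreover have "gcd (2 * d) (2 * l) = 2"
    using gcd_ld by (simp add: gcd.commute flip: gcd_mult_distrib_nat)
  ultimately have "fr 2 f = f" by simp
  hence "fr d f = f" using fr_fixed_mult[of 2 f "d div 2"] d_even by simp
  thus ?thesis using assms eq_neg_imp_0 by metis
qed

section \<open>Squares, nonsquares and elements of norm one\<close>

text \<open>Euler's criterion: half the order of the multiplicative group is
  \<open>q ^ l - 1\<close> times \<open>(q ^ l + 1) / 2\<close>, which is \<open>h + 1\<close>
  below, and nonzero elements of K already have exponent \<open>q ^ l - 1\<close>.\<close>

lemma is_square_if_fixed:
  assumes "fr l x = x"
  shows "is_square x"
proof (cases "x = 0")
  case False
  have odd_Q: "odd (q ^ l)" using q_odd by simp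
  obtain h where h: "q ^ l = 2 * h + 1" using odd_Q by (elim oddE)
  have Q: "CARD('a) - 1 = 2 * ((q ^ l - 1) * (h + 1))"
  proof -
    have "q ^ (2 * l) = (2 * h + 1) * (2 * h + 1)" by (metis h mult_2 power_add)
    thus ?thesis by (simp add: card_F h algebra_simps)
  qed
  have "x * x ^ (q ^ l - 1) = x"
    using assms unfolding fr_def h by simp
  hence "x ^ (q ^ l - 1) = 1" using False by simp
  hence z: "x ^ ((q ^ l - 1) * (h + 1)) = 1"
    by (simp only: power_mult power_one)
  have "card {y :: 'a. y ^ 2 = 1} \<le> card {1, -1 :: 'a}"
    by (intro card_mono) (auto simp: power2_eq_1_iff)
  also have "\<dots> \<le> 2" by (simp add: card_insert_if)
  finally have "\<exists>y. y \<noteq> 0 \<and> y ^ 2 = x"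
    by (rule finite_field_nth_root) (use Q z in simp_all)
  thus ?thesis by (auto simp: is_nth_power_def)
qed simp

lemma is_square_fr_add_id: "is_square (x * fr k x)"
proof -
  have "even (q ^ k + 1)" using q_odd by simp
  moreover have "x * fr k x = x ^ (q ^ k + 1)" by (simp add: fr_def)
  ultimately show ?thesis by (metis is_nth_powerI evenE power_mult mult.commute)
qed

lemma \<beta>_nonzero: "\<beta> \<noteq> 0"
  using \<beta>_nonsquare by auto

lemma is_square_cancel:
  fixes x y :: 'a
  assumes "is_square (x * y)" "is_square x" "x \<noteq> 0"
  shows "is_square y"
proof -
  obtain a b where "x * y = a ^ 2" "x = b ^ 2"
    using assms by (auto simp: is_nth_power_def)
  hence "y = (a / b) ^ 2" using assms(3) by (simp add: power_divide field_simps)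
  thus ?thesis by (metis is_nth_powerI)
qed

text \<open>The form in which the nonsquare hypothesis enters both the zero-divisor argument and the
  choice of \<xi>.\<close>

lemma \<beta>_mult_nonsquare:
  assumes "is_square y" "y \<noteq> 0"
  shows "fr l (y * \<beta>) \<noteq> y * \<beta>"
  using is_square_cancel[OF is_square_if_fixed[of "y * \<beta>"] assms] \<beta>_nonsquare by blast

text \<open>The witness is \<open>1 + x\<close>, except where this vanishes; there \<omega> serves,
  since conjugation negates it.\<close>

lemma hilbert90_quadratic:
  assumes "x * fr l x = 1"
  obtains y where "y \<noteq> 0" "x = y / fr l y"
proof (cases "x = -1")
  case True
  show ?thesis
    by (rule that[of \<omega>]) (use True \<omega>_nonzero fr_bar_\<omega> in simp_all)
next
  case False
  have "x * fr l (1 + x) = 1 + x"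
    using assms by (simp add: fr_add algebra_simps)
  moreover have "1 + x \<noteq> 0" using False by (metis add.right_inverse add_left_cancel)
  ultimately show ?thesis
    by (intro that[of "1 + x"]) (simp_all add: eq_divide_eq)
qed

section \<open>Existence of \<xi>\<close>

text \<open>\<open>l + d\<close> is odd and prime to \<open>l\<close>, hence prime to
  \<open>2 * l\<close>.\<close>

lemma fr_ld_fixed_imp:
  assumes "fr (l + d) x = x"
  shows "fr 1 x = x"
proof -
  have "coprime (l + d) l"
    by (metis add.commute gcd.commute gcd_add1 gcd_ld coprime_iff_gcd_eq_1)
  moreover have "coprime (l + d) 2" using l_odd d_even by simp
  ultimately have "coprime (l + d) (2 * l)"
    by (simp only: coprime_mult_right_iff simp_thms)
  hence "gcd (l + d) (2 * l) = 1" by (rule coprime_imp_gcd_eq_1)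
  thus ?thesis using fr_fixed_gcd[OF assms fr_period] l_pos by simp
qed

text \<open>Since \<open>fr (l + d)\<close> generates the Galois group over the field with \<open>q\<close> elements, this is
  Hilbert 90 for \<open>\<beta> / fr l \<beta>\<close>, which has norm one; counting roots replaces the general theorem.\<close>

lemma ex_\<xi>\<^sub>0: "\<exists>\<xi>. \<xi> \<noteq> 0 \<and> fr (l + d) \<xi> * fr l \<beta> = \<xi> * \<beta>"
proof -
  \<comment> \<open>With this exponent, \<open>x ^ n\<close> is the quotient of
    \<open>fr (l + d) x\<close> by \<open>x\<close> for nonzero \<open>x\<close>.\<close>
  define n where "n = q ^ (l + d) - 1"
  have dvd1: "q - 1 dvd q ^ k - 1" for k
    using cong_to_1_nat[of "q ^ k" "q - 1"] cong_pow[of q 1 "q - 1" k] q_gt_1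
    by (simp add: cong_def le_mod_geq)
  obtain m where m: "q ^ (2 * l) - 1 = (q - 1) * m" using dvd1 by blast
  obtain t where t: "q ^ l - 1 = (q - 1) * t" using dvd1 by blast
  obtain u where u: "n = (q - 1) * u" using dvd1[of "l + d"] unfolding n_def by blast
  have qp: "q ^ k = Suc (q ^ k - 1)" for k using q_gt_1 by simp
  have fr_pow: "fr k x = x * x ^ (q ^ k - 1)" for k x
    unfolding fr_def by (subst qp) simp
  have "{x :: 'a. x ^ n = 1} \<subseteq> subfield_Fq q 1 - {0}"
  proof
    fix x :: 'a assume x: "x \<in> {x. x ^ n = 1}"
    have "n > 0" using q_gt_1 l_pos one_less_power[of q "l + d"] by (simp add: n_def)
    hence x0: "x \<noteq> 0" using x by (auto simp: power_0_left)
    have "fr (l + d) x = x" using x fr_pow[of "l + d" x] by (simp add: n_def)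
    thus "x \<in> subfield_Fq q 1 - {0}" using x0 fr_ld_fixed_imp by (simp add: mem_subfield_iff)
  qed
  hence "card {x :: 'a. x ^ n = 1} \<le> card (subfield_Fq q 1 - {0 :: 'a})"
    by (intro card_mono) simp
  also have "\<dots> = q - 1"
    using card_subfield_Fq[OF q_pp card_F, of 1] l_pos
    by (simp add: card_Diff_subset mem_subfield_iff)
  finally have ker: "card {x :: 'a. x ^ n = 1} \<le> q - 1" .
  have \<beta>Q: "\<beta> ^ (q ^ (2 * l) - 1) = 1"
    using fr_pow[of "2 * l" \<beta>] \<beta>_nonzero by simp
  \<comment> \<open>The \<open>m\<close>-th power is the norm to the field with \<open>q\<close>
    elements. Since \<open>q - 1\<close> divides \<open>q ^ l - 1\<close>, the total exponent of
    \<beta> is a multiple of the group order.\<close>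
  have "(1 / \<beta> ^ (q ^ l - 1)) ^ m = 1 / (\<beta> ^ ((q - 1) * m)) ^ t"
    unfolding t by (simp add: power_divide mult_ac flip: power_mult)
  also have "\<dots> = 1" using \<beta>Q m by simp
  finally have z: "(1 / \<beta> ^ (q ^ l - 1)) ^ m = 1" .
  have "\<exists>x. x \<noteq> 0 \<and> x ^ n = 1 / \<beta> ^ (q ^ l - 1)"
    by (rule finite_field_nth_root[OF ker _ _ z]) (unfold card_F m u, simp_all add: mult_ac)
  then obtain x where x: "x \<noteq> 0" "x ^ n = 1 / \<beta> ^ (q ^ l - 1)" by blast
  have "fr (l + d) x = x * x ^ n" unfolding n_def by (rule fr_pow)
  hence "fr (l + d) x * fr l \<beta> = x * \<beta>"
    using x \<beta>_nonzero by (simp add: fr_pow[of l \<beta>])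
  thus ?thesis using x(1) by blast
qed

lemma ex_\<xi>: "\<exists>\<xi>. \<xi> * fr l \<xi> = \<sigma> \<and> fr (l + d) \<xi> * fr l \<beta> = \<xi> * \<beta>"
proof -
  obtain x where x: "x \<noteq> 0" "fr (l + d) x * fr l \<beta> = x * \<beta>" using ex_\<xi>\<^sub>0 by blast
  have scale: "fr (l + d) (c * x) * fr l \<beta> = c * x * \<beta>" if "fr 1 c = c" for c
    using x(2) fr_fixed_mult[OF that, of "l + d"] by (simp add: fr_mult mult.assoc)
  define n where "n = x * fr l x"
  have n0: "n \<noteq> 0" using x(1) by (simp add: n_def)
  have x_bar: "fr (l + d) (fr l x) * \<beta> = fr l x * fr l \<beta>"
    using arg_cong[OF x(2), of "fr l"] by (simp add: fr_mult fr_commute[of l "l + d"])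
  \<comment> \<open>The twist equation times its conjugate: the norm of \<beta> cancels.\<close>
  have "fr (l + d) n * (\<beta> * fr l \<beta>) = n * (\<beta> * fr l \<beta>)"
    using arg_cong2[OF x(2) x_bar, of "(*)"] by (simp only: n_def fr_mult mult_ac)
  hence "fr (l + d) n = n" using \<beta>_nonzero by simp
  hence n1: "fr 1 n = n" by (rule fr_ld_fixed_imp)
  \<comment> \<open>A root \<open>r\<close> exists in F because \<open>n\<close> lies in K; whether
    \<open>fr 1\<close> fixes or negates \<open>r\<close> decides whether \<open>n\<close> is a
    square in the field with \<open>q\<close> elements.\<close>
  hence "is_square n" using fr_fixed_mult[of 1 n l] is_square_if_fixed by simp
  then obtain r where r: "n = r ^ 2" by (auto simp: is_nth_power_def)
  have r0: "r \<noteq> 0" using n0 r by auto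
  have "fr 1 r ^ 2 = r ^ 2" using n1 by (simp only: r fr_power)
  hence "fr 1 r = r \<or> fr 1 r = - r" by (simp only: power2_eq_iff)
  thus ?thesis
  proof
    assume r1: "fr 1 r = r"
    define z where "z = 1 / r * x"
    have "fr l r = r" using fr_fixed_mult[OF r1, of l] by simp
    hence "z * fr l z = n / r ^ 2" by (simp add: z_def n_def fr_mult fr_divide power2_eq_square)
    hence "z * fr l z = 1" using r r0 by simp
    then obtain y where y: "y \<noteq> 0" "z = y / fr l y" by (rule hilbert90_quadratic)
    have "fr 1 (1 / r) = 1 / r" by (simp only: fr_divide r1 fr_1)
    hence "fr (l + d) z * fr l \<beta> = z * \<beta>" unfolding z_def by (rule scale)
    \<comment> \<open>Substituting \<open>y / fr l y\<close> for \<open>z\<close> in the twist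
      equation puts \<open>y / fr (l + d) y * \<beta>\<close> in K.\<close>
    hence "fr (l + d) y * fr l y * fr l \<beta> = y * fr (l + d) (fr l y) * \<beta>"
      using y by (simp add: fr_divide field_simps)
    hence "fr l (y / fr (l + d) y * \<beta>) = y / fr (l + d) y * \<beta>"
      unfolding fr_mult fr_divide fr_commute[of l "l + d"]
      using y(1) by (simp add: frac_eq_eq) (simp add: mult_ac)
    \<comment> \<open>This is \<open>y / fr (l + d) y\<close>, expanded to an even power of
      \<open>y\<close> over a square.\<close>
    moreover have "is_square (y * fr (l + d) y / (fr (l + d) y) ^ 2)"
      using is_square_fr_add_id[of y "l + d"]
      by (auto simp: is_nth_power_def simp flip: power_divide)
    hence "fr l (y / fr (l + d) y * \<beta>) \<noteq> y / fr (l + d) y * \<beta>"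
      using y(1) by (intro \<beta>_mult_nonsquare) (auto simp: power2_eq_square)
    ultimately show ?thesis by contradiction
  next
    assume r1: "fr 1 r = - r"
    \<comment> \<open>\<open>fr 1\<close> negates both \<omega> and \<open>r\<close>, so it fixes
      \<open>c\<close>; scaling by \<open>c\<close> multiplies the norm \<open>n\<close> by
      \<open>\<sigma> / n\<close>.\<close>
    define c where "c = \<omega> / r"
    have c1: "fr 1 c = c" by (simp only: c_def fr_divide r1 fr_1_\<omega> minus_divide_divide)
    have "fr l c = c" using fr_fixed_mult[OF c1, of l] by simp
    hence "c * x * fr l (c * x) = c ^ 2 * n"
      by (simp add: fr_mult n_def power2_eq_square)
    also have "\<dots> = \<sigma>" using r r0 \<omega>\<sigma> by (simp add: c_def power_divide)
    finally show ?thesis using scale[OF c1] by blast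
  qed
qed

section \<open>The two products in coordinates, and absence of zero divisors\<close>

lemma omega_coords_props:
  shows "fr l (fst (omega_coords q l \<omega> y)) = fst (omega_coords q l \<omega> y)"
    and "fr l (snd (omega_coords q l \<omega> y)) = snd (omega_coords q l \<omega> y)"
    and "fst (omega_coords q l \<omega> y) + snd (omega_coords q l \<omega> y) * \<omega> = y"
  using theI'[OF omega_coords_unique[OF q_pp l_odd card_F \<omega>2 \<omega>1, of y]]
  by (auto simp: omega_coords_def mem_subfield_iff)

lemma omega_coords_eqI:
  assumes "fr l A = A" "fr l B = B"
  shows "omega_coords q l \<omega> (A + B * \<omega>) = (A, B)"
  unfolding omega_coords_def
  by (rule the1_equality[OF omega_coords_unique[OF q_pp l_odd card_F \<omega>2 \<omega>1]])
     (use assms in \<open>simp add: mem_subfield_iff\<close>)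

lemma omega_coords_cases:
  obtains A B where "fr l A = A" "fr l B = B" "y = A + B * \<omega>"
  using omega_coords_props[of y] by metis

lemma star_prime_eq:
  assumes "fr l A = A" "fr l B = B"
  shows "star_prime q l d \<omega> \<sigma> \<beta> x (A + B * \<omega>) =
    2 * (A * fr l x + fr (2 * l - d) (\<sigma> * \<beta> * B * x) + \<sigma> * \<beta> * B * fr d x)"
  unfolding star_prime_def omega_coords_eqI[OF assms] 
  by (simp add: fr_mult) (simp add: fr_def algebra_simps)

lemma star_dprime_eq:
  assumes "fr l A = A" "fr l B = B"
  shows "star_dprime q l d \<omega> \<sigma> \<beta> \<xi> x (A + B * \<omega>) =
    2 * (A * x + \<sigma> * \<omega> / fr l \<xi> * (\<beta> * B * fr d x + fr (2 * l - d) (\<beta> * B * x)))"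
  unfolding star_dprime_def omega_coords_eqI[OF assms]
  by (simp add: fr_mult) (simp add: fr_def algebra_simps add_divide_distrib)

lemma presemifield_star_prime: "presemifield (star_prime q l d \<omega> \<sigma> \<beta>)"
  unfolding presemifield_def
proof (intro conjI allI impI)
  fix x y z :: 'a
  obtain A B where y: "fr l A = A" "fr l B = B" "y = A + B * \<omega>" by (rule omega_coords_cases)
  obtain C D where z: "fr l C = C" "fr l D = D" "z = C + D * \<omega>" by (rule omega_coords_cases)
  have yz: "fr l (A + C) = A + C" "fr l (B + D) = B + D" "y + z = (A + C) + (B + D) * \<omega>"
    using y z by (simp_all add: fr_add algebra_simps)
  show "star_prime q l d \<omega> \<sigma> \<beta> x (y + z) = star_prime q l d \<omega> \<sigma> \<beta> x y + star_prime q l d \<omega> \<sigma> \<beta> x z"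
    unfolding yz(3) star_prime_eq[OF yz(1,2)] unfolding y(3) z(3)
      star_prime_eq[OF y(1,2)] star_prime_eq[OF z(1,2)]
    by (simp add: fr_add fr_mult algebra_simps)
  show "star_prime q l d \<omega> \<sigma> \<beta> (x + y) z = star_prime q l d \<omega> \<sigma> \<beta> x z + star_prime q l d \<omega> \<sigma> \<beta> y z"
    unfolding z(3) star_prime_eq[OF z(1,2)] by (simp add: fr_add fr_mult algebra_simps)
next
  fix x y :: 'a
  assume eq: "star_prime q l d \<omega> \<sigma> \<beta> x y = 0"
  obtain A B where y: "fr l A = A" "fr l B = B" "y = A + B * \<omega>" by (rule omega_coords_cases)
  show "x = 0 \<or> y = 0"
  proof (cases "x = 0")
    case False
    \<comment> \<open>Multiplying the vanishing product by \<open>x\<close> turns its terms into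
      \<open>?N\<close>, which lies in K, the preimage of \<open>e\<close> under
      \<open>fr d\<close>, and \<open>e\<close> itself.\<close>
    define e where "e = \<sigma> * B * (x * fr d x) * \<beta>"
    let ?N = "A * (x * fr l x)"
    have "A * fr l x + fr (2 * l - d) (\<sigma> * \<beta> * B * x) + \<sigma> * \<beta> * B * fr d x = 0"
      using eq two_nonzero unfolding y(3) star_prime_eq[OF y(1,2)] by (metis mult_eq_0_iff)
    moreover have "?N + fr (2 * l - d) e + e =
        x * (A * fr l x + fr (2 * l - d) (\<sigma> * \<beta> * B * x) + \<sigma> * \<beta> * B * fr d x)"
      by (simp add: e_def fr_mult distrib_left)
    ultimately have e: "?N + fr (2 * l - d) e + e = 0" by simp
    have N: "fr l (fr d ?N) = fr d ?N"
      by (simp add: fr_mult y(1) fr_commute[of l d] mult_ac)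
    have fe: "fr d e = - (fr d ?N + e)"
    proof (rule eq_neg_iff_add_eq_0[THEN iffD2])
      show "fr d e + (fr d ?N + e) = 0"
        using arg_cong[OF e, of "fr d"] by (simp add: fr_add add_ac)
    qed
    \<comment> \<open>Conjugating \<open>fe\<close> leaves \<open>fr d ?N\<close> unchanged, so it
      cancels in the difference.\<close>
    have "fr d (fr l e) = - (fr d ?N + fr l e)"
      unfolding fr_commute[of d l] fe fr_minus fr_add N ..
    with fe have "fr d (e - fr l e) = - (e - fr l e)"
      by (simp add: fr_diff)
    hence "fr l e = e" using fr_d_neg_imp_0[of "e - fr l e"] by simp
    moreover have "is_square (\<sigma> * B * (x * fr d x))"
      by (intro is_nth_power_mult is_square_if_fixed is_square_fr_add_id)
         (simp add: fr_mult fr_\<sigma> y(2))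
    ultimately have "\<sigma> * B * (x * fr d x) = 0"
      using \<beta>_mult_nonsquare unfolding e_def by blast
    hence B: "B = 0" using False \<sigma>0 by simp
    hence "A = 0" using e False by (simp add: e_def)
    thus ?thesis using B y(3) by simp
  qed simp
qed

section \<open>The isotopism\<close>

lemma isotopic_star_dprime:
  assumes norm: "\<xi> * fr l \<xi> = \<sigma>" and twist: "fr (l + d) \<xi> * fr l \<beta> = \<xi> * \<beta>"
  shows "isotopic (star_prime q l d \<omega> \<sigma> \<beta>) (star_dprime q l d \<omega> \<sigma> \<beta> \<xi>)"
proof -
  have \<xi>0: "\<xi> \<noteq> 0" using norm \<sigma>0 by auto
  \<comment> \<open>Up to \<sigma>, the coefficient in \<open>star_dprime\<close>. Its norm is -1:
    conjugation negates \<omega>, and the norm of \<xi> is the square of \<omega>.\<close>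
  define a where "a = \<omega> / fr l \<xi>"
  have a0: "a * fr l a = -1"
    using norm \<sigma>0 \<omega>\<sigma> by (simp add: a_def fr_divide fr_bar_\<omega> power2_eq_square mult.commute)
  define L where "L = (\<lambda>z. a * z + fr l z)"
  define M where "M = (\<lambda>z. z + a * fr l z)"
  have L: "additive L" by standard (simp add: L_def fr_add algebra_simps)
  have M: "additive M" by standard (simp add: M_def fr_add algebra_simps)
  have L0: "z = 0" if "L z = 0" for z
  proof (rule ccontr)
    assume "z \<noteq> 0"
    have z: "a * z = - fr l z" using that by (simp add: L_def eq_neg_iff_add_eq_0)
    have z_bar: "fr l a * fr l z = - z"
      using arg_cong[OF z, of "fr l"] by (simp add: fr_mult fr_minus)
    \<comment> \<open>Multiplying \<open>z\<close> by its conjugate equation: norm -1 of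
      \<open>a\<close> makes the norm of the element its own negative.\<close>
    have "(a * fr l a) * (z * fr l z) = z * fr l z"
      using arg_cong2[OF z z_bar, of "(*)"] by (simp add: mult_ac)
    hence "z * fr l z = - (z * fr l z)" using a0 by simp
    hence "z * fr l z = 0" by (rule eq_neg_imp_0)
    thus False using \<open>z \<noteq> 0\<close> by simp
  qed
  have "inj L"
    by (rule injI) (metis L0 additive.diff[OF L] eq_iff_diff_eq_0)
  hence bij_L: "bij L" by (simp add: bij_def finite_UNIV_inj_surj)
  have "bij (fr l)" by (rule involuntory_imp_bij) simp
  moreover have "M = L \<circ> fr l" by (auto simp: M_def L_def add.commute)
  ultimately have bij_M: "bij M" using bij_L bij_comp by blast
  \<comment> \<open>The twist condition on \<xi> in terms of \<open>a\<close>; \<omega> is fixed by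
    \<open>fr d\<close> because \<open>d\<close> is even.\<close>
  have a_d: "a * fr d a * \<beta> = fr l \<beta>"
  proof -
    have "fr l \<xi> * fr d (fr l \<xi>) * fr l \<beta> = \<sigma> * \<beta>"
      using twist norm by (simp add: fr_fr add.commute) (metis mult.assoc mult.commute)
    thus ?thesis
      using \<xi>0 \<omega>\<sigma> by (simp add: a_def fr_divide fr_even_\<omega> d_even power2_eq_square field_simps)
  qed
  have a_d': "a * fr (2 * l - d) a * fr (2 * l - d) \<beta> = fr (2 * l - d) (fr l \<beta>)"
    using arg_cong[OF a_d, of "fr (2 * l - d)"] by (simp add: fr_mult) (simp add: mult_ac)
  have iso: "star_dprime q l d \<omega> \<sigma> \<beta> \<xi> (M x) y = L (star_prime q l d \<omega> \<sigma> \<beta> x y)" for x y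
  proof -
    obtain A B where y: "fr l A = A" "fr l B = B" "y = A + B * \<omega>" by (rule omega_coords_cases)
    have L2: "L (2 * z) = 2 * L z" for z
      by (simp only: mult_2 additive.add[OF L])
    have bar: "fr l (A * fr l x + fr (2 * l - d) (\<sigma> * \<beta> * B * x) + \<sigma> * \<beta> * B * fr d x) =
        A * x + \<sigma> * fr (2 * l - d) (fr l \<beta>) * fr (2 * l - d) B * fr (2 * l - d) (fr l x)
        + \<sigma> * fr l \<beta> * B * fr d (fr l x)"
      by (simp add: fr_add fr_mult y(1,2) fr_\<sigma> fr_commute[of l d] fr_commute[of l "2 * l - d"])
    \<comment> \<open>The terms in \<open>x\<close> match directly. Of the terms in its conjugate,
      the one with \<open>A\<close> matches through the factor \<open>a\<close> of \<open>L\<close>,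
      the twisted ones through \<open>a_d\<close> and \<open>a_d'\<close>.\<close>
    have "A * M x + \<sigma> * a * (\<beta> * B * fr d (M x) + fr (2 * l - d) (\<beta> * B * M x)) =
        L (A * fr l x + fr (2 * l - d) (\<sigma> * \<beta> * B * x) + \<sigma> * \<beta> * B * fr d x)"
      unfolding L_def bar a_d'[symmetric] unfolding M_def fr_add fr_mult fr_\<sigma> a_d[symmetric]
      by (simp add: algebra_simps)
    thus ?thesis
      unfolding y(3) star_prime_eq[OF y(1,2)] star_dprime_eq[OF y(1,2)] L2
      by (simp add: a_def)
  qed
  have "additive (id :: 'a \<Rightarrow> 'a)" by standard simp
  thus ?thesis
    unfolding isotopic_def using L M bij_L bij_M iso
    by (intro exI[of _ M] exI[of _ id] exI[of _ L]) auto
qed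

text \<open>The negative power of \<beta> is \<open>\<beta> / fr l \<beta>\<close>; the working form
  clears this denominator.\<close>

lemma \<xi>_power_iff:
  assumes "\<xi> \<noteq> 0"
  shows "\<xi> ^ (q ^ (l + d) - 1) = \<beta> powi (1 - int (q ^ l)) \<longleftrightarrow>
    fr (l + d) \<xi> * fr l \<beta> = \<xi> * \<beta>"
proof -
  have "q ^ (l + d) = Suc (q ^ (l + d) - 1)" using q_gt_1 by simp
  hence \<xi>_eq: "fr (l + d) \<xi> = \<xi> * \<xi> ^ (q ^ (l + d) - 1)"
    unfolding fr_def by (metis power_Suc)
  have \<beta>_eq: "\<beta> powi (1 - int (q ^ l)) = \<beta> / fr l \<beta>"
    using \<beta>_nonzero by (simp only: power_int_diff power_int_of_nat fr_def power_int_1_right simp_thms)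
  show ?thesis
    unfolding \<xi>_eq \<beta>_eq using assms \<beta>_nonzero by (simp add: eq_divide_eq)
qed

end

theorem theorem4p4:
  fixes q l d :: nat and \<omega> \<sigma> \<beta> :: "'a :: finite_field"
  assumes "primepow q" and "odd q"
    and "odd l" and "even d" and "0 < d" and "d < 2 * l" and "gcd l d = 1"
    and "CARD('a) = q ^ (2 * l)"
    and "\<omega> \<in> subfield_Fq q 2" and "\<omega> \<notin> subfield_Fq q 1"
    and "\<sigma> \<in> subfield_Fq q 1" and "\<sigma> \<noteq> 0" and "\<omega> ^ 2 = \<sigma>"
    and "\<not> is_square \<beta>"
  shows "presemifield (star_prime q l d \<omega> \<sigma> \<beta>) \<and>
    (\<exists>\<xi>. \<xi> ^ (q ^ (l + d) - 1) = \<beta> powi (1 - int (q ^ l)) \<and>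
         \<xi> ^ (q ^ l + 1) = \<sigma> \<and>
         presemifield (star_dprime q l d \<omega> \<sigma> \<beta> \<xi>) \<and>
         isotopic (star_prime q l d \<omega> \<sigma> \<beta>) (star_dprime q l d \<omega> \<sigma> \<beta> \<xi>))"
proof -
  interpret quadratic_setting q l d \<omega> \<sigma> \<beta>
    by unfold_locales (use assms in auto)
  obtain \<xi> where \<xi>: "\<xi> * fr l \<xi> = \<sigma>" "fr (l + d) \<xi> * fr l \<beta> = \<xi> * \<beta>"
    using ex_\<xi> by blast
  have "\<xi> \<noteq> 0" using \<xi>(1) \<sigma>0 by auto
  hence "\<xi> ^ (q ^ (l + d) - 1) = \<beta> powi (1 - int (q ^ l))"
    using \<xi>(2) \<xi>_power_iff by simp
  moreover have "\<xi> ^ (q ^ l + 1) = \<sigma>" using \<xi>(1) by (simp add: fr_def)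
  ultimately show ?thesis
    using presemifield_star_prime isotopic_star_dprime[OF \<xi>] isotopic_presemifield by blast
qed

end
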